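(* Let $r,n\ge 1$ be integers and let $\omega$ be a primitive $r$th root of unity. For all $a\in\{0,1\}$ and $b\in\{0,1,\dots,r-1\}$, $$\sum_{\pi\in G(r,n)} \chi_{a,b}(\pi)\,q^{\ell(\pi)}=\prod_{k=1}^n[k]_{(-1)^aq}\left(1+(-1)^{a(k-1)}\omega^bq^k[r-1]_{\omega^bq}\right),$$ and $$\sum_{\pi\in G(r,n)} \chi_{a,b}(\pi)\,q^{\mathrm{lmaj}(\pi)}=\prod_{k=1}^n[k]_{(-1)^{a(k-1)}q}\left(1+(-1)^{a(k-1)}\omega^bq^k[r-1]_{\omega^bq}\right).$$
   Context: For an integer $m\ge 0$ and any quantity $p$, $[m]_p:=1+p+p^2+\cdots+p^{m-1}$ (so $[0]_p=0$). $G(r,n)=C_r\wr\mathfrak S_n$ is the group of $r$-colored permutations. An element is a word $\pi=\pi_1\cdots\pi_n=\sigma_1^{[z_1]}\cdots\sigma_n^{[z_n]}$ with $\sigma\in\mathfrak S_n$ and colors $z_i\in\{0,1,\dots,r-1\}$ (representing $\mathbb Z_r$); we write $|\pi_i|=\sigma_i$ and $i^{[0]}=i$. It is identified with the bijection of $\{i^{[t]}:1\le i\le n,\ t\in\mathbb Z_r\}$ given by $\pi(i^{[t]})=\sigma_i^{[z_i+t]}$ (equivalently, $i^{[t]}$ stands for $\omega^t i$), and multiplication is composition, $(\pi\rho)(x)=\pi(\rho(x))$. The group is generated by $\mathcal S=\{s_0,s_1,\dots,s_{n-1}\}$, where $s_i$ ($i\ge1$) is the transposition exchanging $i$ and $i+1$,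 and $s_0$ maps $1\mapsto 1^{[1]}$ and fixes $2,\dots,n$. $\ell(\pi)$ is the length of $\pi$ with respect to $\mathcal S$, i.e. the minimal number of factors in an expression of $\pi$ as a product of elements of $\mathcal S$. Equivalently (Bagno), $\ell(\pi)=\mathrm{inv}(\pi)+\sum_{i:\,z_i>0}(|\pi_i|+z_i-1)$, where $\mathrm{inv}(\pi)=|\{(i,j): i<j,\ \pi_i>\pi_j\}|$ with respect to the linear order $$(n^{[r-1]}<\cdots<n^{[1]})<\cdots<(1^{[r-1]}<\cdots<1^{[1]})<(1<\cdots<n).$$ With respect to the same order, $\mathrm{maj}(\pi)=\sum_{1\le i\le n-1,\ \pi_i>\pi_{i+1}} i$, and $$\mathrm{lmaj}(\pi):=\mathrm{maj}(\pi)+\sum_{i:\,z_i>0}(|\pi_i|+z_i-1).$$ Put $\mathrm{col}(\pi):=\sum_{i=1}^n z_i$ (an integer sum). The one-dimensional characters are $$\chi_{a,b}(\pi)=(-1)^{a(\ell(\pi)-\mathrm{col}(\pi))}\,\omega^{b\,\mathrm{col}(\pi)},\qquad a\in\{0,1\},\ b\in\{0,\dots,r-1\}.$$ *)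

theory Defs
  imports Complex_Main "HOL-Combinatorics.Permutations" "HOL-Computational_Algebra.Polynomial"
begin

(* (i, t) stands for the colored integer i^[t]. *)
type_synonym colored = "nat \<times> nat"

(* A colored permutation is represented by its word pi_1 ... pi_n, as the function i \<mapsto> pi_i. *)
type_synonym colored_word = "nat \<Rightarrow> colored"

(* Outside {1..n} a word is extended by i \<mapsto> (i, 0), so that it is determined by
   its letters pi_1, ..., pi_n. *)
definition G :: "nat \<Rightarrow> nat \<Rightarrow> colored_word set" where
  "G r n = {\<pi>. (\<lambda>i. fst (\<pi> i)) permutes {1..n} \<and>
                (\<forall>i\<in>{1..n}. snd (\<pi> i) < r) \<and>
                (\<forall>i. i \<notin> {1..n} \<longrightarrow> snd (\<pi> i) = 0)}"

(* The map i^[t] \<mapsto> sigma_i^[z_i + t] that a word is identified with. *)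
definition act :: "nat \<Rightarrow> colored_word \<Rightarrow> colored \<Rightarrow> colored" where
  "act r \<pi> x = (fst (\<pi> (fst x)), (snd (\<pi> (fst x)) + snd x) mod r)"

definition cid :: colored_word where
  "cid = (\<lambda>i. (i, 0))"

(* The word of the composition of the two maps; see act_cmult. *)
definition cmult :: "nat \<Rightarrow> colored_word \<Rightarrow> colored_word \<Rightarrow> colored_word" where
  "cmult r \<pi> \<rho> = (\<lambda>i. act r \<pi> (\<rho> i))"

lemma act_cmult: "act r (cmult r \<pi> \<rho>) = act r \<pi> \<circ> act r \<rho>"
  by (auto simp: act_def cmult_def mod_simps add.assoc)

lemma act_zero: "\<pi> \<in> G r n \<Longrightarrow> i \<in> {1..n} \<Longrightarrow> act r \<pi> (i, 0) = \<pi> i"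
  by (auto simp: act_def G_def prod_eq_iff)

(* For r = 1 the color 1 is the color 0, and the generator s_0 is the identity. *)
definition gen :: "nat \<Rightarrow> nat \<Rightarrow> colored_word" where
  "gen r i = (if i = 0 then cid(1 := (1, 1 mod r))
              else (\<lambda>j. (Transposition.transpose i (i + 1) j, 0)))"

definition gens :: "nat \<Rightarrow> nat \<Rightarrow> colored_word set" where
  "gens r n = {gen r i | i. i < n}"

definition len :: "nat \<Rightarrow> nat \<Rightarrow> colored_word \<Rightarrow> nat" where
  "len r n \<pi> = (LEAST k. \<exists>ws. length ws = k \<and> set ws \<subseteq> gens r n \<and> foldr (cmult r) ws cid = \<pi>)"

(* The linear order
   (n^[r-1] < ... < n^[1]) < ... < (1^[r-1] < ... < 1^[1]) < (1 < ... < n). *)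
definition cless :: "colored \<Rightarrow> colored \<Rightarrow> bool" where
  "cless x y \<longleftrightarrow>
     (if snd x = 0 then snd y = 0 \<and> fst x < fst y
      else snd y = 0 \<or> fst y < fst x \<or> (fst x = fst y \<and> snd y < snd x))"

definition maj :: "nat \<Rightarrow> colored_word \<Rightarrow> nat" where
  "maj n \<pi> = (\<Sum>i | 1 \<le> i \<and> i < n \<and> cless (\<pi> (i + 1)) (\<pi> i). i)"

definition lmaj :: "nat \<Rightarrow> colored_word \<Rightarrow> nat" where
  "lmaj n \<pi> = maj n \<pi> + (\<Sum>i | i \<in> {1..n} \<and> snd (\<pi> i) > 0. fst (\<pi> i) + snd (\<pi> i) - 1)"

definition col :: "nat \<Rightarrow> colored_word \<Rightarrow> nat" where
  "col n \<pi> = (\<Sum>i=1..n. snd (\<pi> i))"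

definition primitive_root_of_unity :: "nat \<Rightarrow> complex \<Rightarrow> bool" where
  "primitive_root_of_unity r \<omega> \<longleftrightarrow> \<omega> ^ r = 1 \<and> (\<forall>k. 0 < k \<and> k < r \<longrightarrow> \<omega> ^ k \<noteq> 1)"

definition chi :: "nat \<Rightarrow> nat \<Rightarrow> complex \<Rightarrow> nat \<Rightarrow> nat \<Rightarrow> colored_word \<Rightarrow> complex" where
  "chi r n \<omega> a b \<pi> =
     (-1) powi (int a * (int (len r n \<pi>) - int (col n \<pi>))) * \<omega> ^ (b * col n \<pi>)"

definition qint :: "nat \<Rightarrow> 'a::comm_semiring_1 \<Rightarrow> 'a" where
  "qint m p = (\<Sum>i<m. p ^ i)"

(* The indeterminate q. *)
abbreviation qvar :: "complex poly" where
  "qvar \<equiv> [:0, 1:]"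

end

theory Submission
  imports Defs "HOL-Combinatorics.Multiset_Permutations"
begin

text \<open>
  The idea is to separate the colors of a colored permutation from the order of its letters. Give
  each absolute value \<open>v\<close> its color and regard the letter as the integer \<open>v\<close> if the color is \<open>0\<close> and
  as \<open>- v\<close> otherwise. The order on colored integers, restricted to letters with distinct absolute
  values, is then the order of the integers, and the words with a given color assignment are all the
  arrangements of a set of \<open>n\<close> integers.

  Everything in the sums splits accordingly. By Bagno's formula (\<open>len_eq_bagno\<close>) the length is the
  inversion number of the word plus a contribution of each colored letter, and \<open>lmaj\<close> is the major
  index plus the same contribution. The contribution of a letter with absolute value \<open>v\<close> and color
  \<open>z > 0\<close> is \<open>v + z - 1\<close>, so after subtracting the colors the sign in the character has the
  exponent \<open>inv\<close> plus the sum of \<open>v - 1\<close> over the colored letters. Therefore each sum is the product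
  of a color part, which factors over \<open>v\<close> and gives \<open>1 + \<epsilon>^(v-1) \<omega>^b q^v [r-1]\<close> with
  \<open>\<epsilon> = (-1)^a\<close> (\<open>sum_color_weight\<close>), and of a sum over arrangements that depends on their number
  of letters only (\<open>sum_G_factor\<close>).

  It remains to sum \<open>(\<epsilon> q)^inv\<close> and \<open>\<epsilon>^inv q^maj\<close> over the arrangements of a set with \<open>n\<close> elements.
  The first is the classical product of the \<open>[k]\<close> at \<open>\<epsilon> q\<close> (\<open>sum_rinv\<close>). The second is MacMahon's
  theorem for \<open>\<epsilon> = 1\<close> and the signed Mahonian formula of Gessel and Simion for \<open>\<epsilon> = -1\<close>. Both
  cases follow from one induction, once the sum is refined by the last letter (\<open>sum_rmaj_Cons\<close>): the
  arrangements ending in \<open>x\<close> contribute \<open>(\<epsilon>^(n-1) q)^j\<close> times the full sum for \<open>n - 1\<close> letters, where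
  \<open>j\<close> is the number of letters greater than \<open>x\<close>.
\<close>

section \<open>Arrangements of a finite linearly ordered set\<close>

text \<open>
  Words are listed from right to left, so that the head is the last letter and removing the last
  letter is structural recursion. The functions below are the inversion number and the major index
  of the reversed list.
\<close>
fun rinv :: "'a::linorder list \<Rightarrow> nat" where
  "rinv [] = 0"
| "rinv (x # xs) = length (filter (\<lambda>y. x < y) xs) + rinv xs"

fun rmaj :: "'a::linorder list \<Rightarrow> nat" where
  "rmaj (x # y # xs) = (if x < y then length (y # xs) else 0) + rmaj (y # xs)"
| "rmaj _ = 0"

lemma qint_add: "qint (m + k) p = qint m p + p ^ m * qint k p"
  by (induction k) (simp_all add: qint_def algebra_simps power_add)

lemma qint_Suc: "qint (Suc k) p = qint k p + p ^ k"
  by (simp add: qint_def)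

text \<open>
  The exponents are the ranks of the elements counted from the top, hence \<open>0, \<dots>, card Y - 1\<close>, each
  taken once.
\<close>
lemma sum_power_card_greater:
  fixes Y :: "'a::linorder set"
  assumes "finite Y"
  shows "(\<Sum>y\<in>Y. p ^ card {z\<in>Y. y < z}) = qint (card Y) p"
  using assms
proof (induction Y rule: finite_linorder_min_induct)
  case empty
  then show ?case by (simp add: qint_def)
next
  case (insert b A)
  have *: "{z\<in>insert b A. y < z} = {z\<in>A. y < z}" if "y \<in> A" for y
    using insert.hyps(2) that by auto
  have b: "{z\<in>insert b A. b < z} = A" "b \<notin> A" using insert.hyps(2) by auto
  have "(\<Sum>y\<in>A. p ^ card {z\<in>insert b A. y < z}) = qint (card A) p"
    unfolding insert.IH[symmetric] by (rule sum.cong) (simp_all only: *)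
  then show ?case
    using insert.hyps(1)
    by (simp only: sum.insert b card_insert_disjoint qint_Suc add.commute not_False_eq_True)
qed

lemma sum_permutations_of_set_Cons:
  assumes "finite X" "X \<noteq> {}"
  shows "(\<Sum>xs\<in>permutations_of_set X. f xs) =
         (\<Sum>x\<in>X. \<Sum>xs\<in>permutations_of_set (X - {x}). f (x # xs))"
proof -
  have "(\<Sum>xs\<in>permutations_of_set X. f xs) =
        (\<Sum>x\<in>X. \<Sum>xs\<in>(#) x ` permutations_of_set (X - {x}). f xs)"
    unfolding permutations_of_set_nonempty[OF assms(2)]
    by (rule sum.UNION_disjoint) (use assms(1) in auto)
  then show ?thesis by (simp add: sum.reindex)
qed

lemma length_filter_permutation:
  assumes "xs \<in> permutations_of_set X"
  shows "length (filter P xs) = card {y\<in>X. P y}"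
proof -
  from assms have "distinct (filter P xs)" "set (filter P xs) = {y\<in>X. P y}"
    by (auto simp: permutations_of_set_def)
  then show ?thesis by (metis distinct_card)
qed

text \<open>
  A last letter \<open>x\<close> forms inversions exactly with the letters greater than \<open>x\<close>, in whatever order
  these stand. So the choice of the last letter contributes the factor \<open>[card X]\<close>.
\<close>
lemma sum_rinv:
  fixes X :: "'a::linorder set"
  assumes "finite X"
  shows "(\<Sum>xs\<in>permutations_of_set X. p ^ rinv xs) = (\<Prod>k=1..card X. qint k p)"
  using assms
proof (induction "card X" arbitrary: X)
  case 0
  then show ?case by simp
next
  case (Suc n)
  then have ne: "X \<noteq> {}" by auto
  have "(\<Sum>xs\<in>permutations_of_set (X - {x}). p ^ rinv (x # xs)) =
        p ^ card {y\<in>X. x < y} * (\<Prod>k=1..n. qint k p)" if x: "x \<in> X" for x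
  proof -
    have "{y \<in> X - {x}. x < y} = {y\<in>X. x < y}" by auto
    then have "(\<Sum>xs\<in>permutations_of_set (X - {x}). p ^ rinv (x # xs)) =
          (\<Sum>xs\<in>permutations_of_set (X - {x}). p ^ card {y\<in>X. x < y} * p ^ rinv xs)"
      by (intro sum.cong) (simp_all add: length_filter_permutation power_add)
    also have "\<dots> = p ^ card {y\<in>X. x < y} * (\<Prod>k=1..n. qint k p)"
      using Suc.hyps(1)[of "X - {x}"] Suc.hyps(2)[symmetric] Suc.prems x
      by (simp add: sum_distrib_left[symmetric])
    finally show ?thesis .
  qed
  then have "(\<Sum>xs\<in>permutations_of_set X. p ^ rinv xs) =
        (\<Sum>x\<in>X. p ^ card {y\<in>X. x < y}) * (\<Prod>k=1..n. qint k p)"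
    by (simp add: sum_permutations_of_set_Cons[OF Suc.prems ne] sum_distrib_right)
  also have "\<dots> = (\<Prod>k=1..card X. qint k p)"
    by (simp add: sum_power_card_greater Suc.prems Suc.hyps(2)[symmetric] mult.commute)
  finally show ?case .
qed

lemma power_mult_consecutive:
  fixes \<epsilon> :: "'b::comm_ring_1"
  assumes "\<epsilon> ^ 2 = 1"
  shows "(\<epsilon> ^ n) ^ Suc n = 1"
proof -
  have "even (n * Suc n)" by simp
  then obtain m where "n * Suc n = 2 * m" by blast
  then show ?thesis by (metis assms power_mult power_one)
qed

text \<open>
  The refinement of the signed Mahonian formula by the last letter \<open>x\<close>. Let \<open>y\<close> be the letter before
  \<open>x\<close>. If \<open>y\<close> is greater than \<open>x\<close>, then there is a descent at position \<open>n\<close>. Write \<open>m\<close> for the number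
  of letters greater than \<open>x\<close>, and \<open>p = \<epsilon>^(n-1) q\<close>, the base that the induction hypothesis gives for
  words ending in \<open>y\<close>. The letters \<open>y\<close> above \<open>x\<close> then contribute \<open>q^n [m]\<close> and those below \<open>x\<close>
  contribute \<open>p^m [n-m]\<close>, with both \<open>q\<close>-integers taken at \<open>p\<close>. As \<open>n (n - 1)\<close> is even, \<open>q^n = p^n\<close>, and
  the two parts recombine to \<open>p^m [n]\<close>. The sign \<open>\<epsilon>^m\<close> of the inversions with \<open>x\<close> turns \<open>p^m\<close> into
  \<open>(\<epsilon>^n q)^m\<close>. In these formulas the word has \<open>n + 1\<close> letters.
\<close>
lemma sum_rmaj_Cons:
  fixes X :: "'a::linorder set" and q \<epsilon> :: "'b::comm_ring_1"
  assumes \<epsilon>: "\<epsilon> ^ 2 = 1" and "finite X" "x \<in> X" "card X = Suc n"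
  shows "(\<Sum>xs\<in>permutations_of_set (X - {x}). \<epsilon> ^ rinv (x # xs) * q ^ rmaj (x # xs)) =
         (\<epsilon> ^ n * q) ^ card {y\<in>X. x < y} * (\<Prod>k=1..n. qint k (\<epsilon> ^ (k - 1) * q))"
  using assms(2-4)
proof (induction n arbitrary: X x)
  case 0
  then have X: "X = {x}" by (auto simp: card_Suc_eq)
  then have none: "{y\<in>X. x < y} = {}" by auto
  show ?case unfolding none using X by simp
next
  case (Suc n)
  \<comment> \<open>Here the word has \<open>n + 2\<close> letters, so that \<open>p\<close> carries \<open>\<epsilon>^n\<close> and the last descent is at \<open>n + 1\<close>.\<close>
  define Y where "Y = X - {x}"
  define U where "U = {y\<in>Y. x < y}"
  define D where "D = {y\<in>Y. y < x}"
  define m where "m = card U"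
  define p where "p = \<epsilon> ^ n * q"
  define S where "S = (\<Prod>k=1..n. qint k (\<epsilon> ^ (k - 1) * q))"
  have "finite Y" "card Y = Suc n" using Suc.prems by (simp_all add: Y_def)
  moreover from this have "Y \<noteq> {}" by auto
  ultimately have Y: "finite Y" "card Y = Suc n" "Y \<noteq> {}" by auto
  have Y_split: "Y = U \<union> D" "U \<inter> D = {}" "finite U" "finite D"
    using Y(1) by (auto simp: U_def D_def Y_def)
  then have card_D: "card D + m = Suc n"
    using Y(2) by (simp add: m_def card_Un_disjoint)
  have U_X: "{y\<in>X. x < y} = U" by (auto simp: U_def Y_def)
  have step: "(\<Sum>xs\<in>permutations_of_set (Y - {y}).
        \<epsilon> ^ rinv (x # y # xs) * q ^ rmaj (x # y # xs)) =
      \<epsilon> ^ m * S * ((if x < y then q ^ Suc n else 1) * p ^ card {z\<in>Y. y < z})"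
    if y: "y \<in> Y" for y
  proof -
    have "\<epsilon> ^ rinv (x # y # xs) * q ^ rmaj (x # y # xs) =
          \<epsilon> ^ m * (if x < y then q ^ Suc n else 1) * (\<epsilon> ^ rinv (y # xs) * q ^ rmaj (y # xs))"
      if xs: "xs \<in> permutations_of_set (Y - {y})" for xs
    proof -
      have yxs: "y # xs \<in> permutations_of_set Y"
        using xs y by (auto simp: permutations_of_set_def)
      have "length (filter (\<lambda>z. x < z) (y # xs)) = m"
        using length_filter_permutation[OF yxs] by (simp add: m_def U_def)
      then have "rinv (x # y # xs) = m + rinv (y # xs)" by simp
      moreover have "length xs = n"
        using length_finite_permutations_of_set[OF xs] y Y by simp
      ultimately show ?thesis by (simp add: power_add ac_simps del: rinv.simps)
    qed
    then have "(\<Sum>xs\<in>permutations_of_set (Y - {y}).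
        \<epsilon> ^ rinv (x # y # xs) * q ^ rmaj (x # y # xs)) =
        \<epsilon> ^ m * (if x < y then q ^ Suc n else 1) * (\<Sum>xs\<in>permutations_of_set (Y - {y}).
          \<epsilon> ^ rinv (y # xs) * q ^ rmaj (y # xs))"
      by (simp add: sum_distrib_left del: rinv.simps rmaj.simps)
    also have "\<dots> = \<epsilon> ^ m * (if x < y then q ^ Suc n else 1) * (p ^ card {z\<in>Y. y < z} * S)"
      by (subst Suc.IH) (use Y y in \<open>simp_all add: p_def S_def\<close>)
    finally show ?thesis by (simp add: ac_simps)
  qed
  have up: "(\<Sum>y\<in>U. p ^ card {z\<in>Y. y < z}) = qint m p"
  proof -
    have "{z\<in>Y. y < z} = {z\<in>U. y < z}" if "y \<in> U" for y using that by (auto simp: U_def)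
    then show ?thesis using sum_power_card_greater[of U p] Y_split(3) by (simp add: m_def)
  qed
  have down: "(\<Sum>y\<in>D. p ^ card {z\<in>Y. y < z}) = p ^ m * qint (card D) p"
  proof -
    have "card {z\<in>Y. y < z} = m + card {z\<in>D. y < z}" if "y \<in> D" for y
    proof -
      have "{z\<in>Y. y < z} = U \<union> {z\<in>D. y < z}" using that by (auto simp: U_def D_def Y_def)
      moreover have "U \<inter> {z\<in>D. y < z} = {}" using Y_split(2) by auto
      ultimately show ?thesis using Y_split by (simp add: m_def card_Un_disjoint)
    qed
    then show ?thesis
      using sum_power_card_greater[of D p] Y_split(4)
      by (simp add: power_add sum_distrib_left[symmetric])
  qed
  have q_p: "q ^ Suc n = p ^ Suc n"
    by (simp only: p_def power_mult_distrib power_mult_consecutive[OF \<epsilon>] mult_1)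
  have "(\<Sum>xs\<in>permutations_of_set (X - {x}). \<epsilon> ^ rinv (x # xs) * q ^ rmaj (x # xs)) =
      \<epsilon> ^ m * S * (\<Sum>y\<in>Y. (if x < y then q ^ Suc n else 1) * p ^ card {z\<in>Y. y < z})"
    unfolding Y_def[symmetric] sum_permutations_of_set_Cons[OF Y(1,3)]
    by (simp add: step sum_distrib_left del: rinv.simps rmaj.simps)
  also have "(\<Sum>y\<in>Y. (if x < y then q ^ Suc n else 1) * p ^ card {z\<in>Y. y < z}) =
      q ^ Suc n * qint m p + p ^ m * qint (card D) p"
  proof -
    have "(\<Sum>y\<in>Y. (if x < y then q ^ Suc n else 1) * p ^ card {z\<in>Y. y < z}) =
      (\<Sum>y\<in>U. (if x < y then q ^ Suc n else 1) * p ^ card {z\<in>Y. y < z}) +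
      (\<Sum>y\<in>D. (if x < y then q ^ Suc n else 1) * p ^ card {z\<in>Y. y < z})"
      using sum.union_disjoint[OF Y_split(3,4,2)] Y_split(1) by simp
    also have "(\<Sum>y\<in>U. (if x < y then q ^ Suc n else 1) * p ^ card {z\<in>Y. y < z}) =
        q ^ Suc n * (\<Sum>y\<in>U. p ^ card {z\<in>Y. y < z})"
      unfolding sum_distrib_left by (rule sum.cong) (simp_all add: U_def)
    also have "(\<Sum>y\<in>D. (if x < y then q ^ Suc n else 1) * p ^ card {z\<in>Y. y < z}) =
        (\<Sum>y\<in>D. p ^ card {z\<in>Y. y < z})"
      by (rule sum.cong) (auto simp: D_def)
    finally show ?thesis by (simp only: up down)
  qed
  also have "\<dots> = p ^ m * qint (Suc n) p"
  proof -
    have "p ^ m * p ^ card D = p ^ Suc n"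
      using card_D by (metis power_add add.commute)
    with q_p have "q ^ Suc n = p ^ m * p ^ card D" by simp
    then have "q ^ Suc n * qint m p + p ^ m * qint (card D) p =
        p ^ m * (qint (card D) p + p ^ card D * qint m p)"
      by (simp add: algebra_simps)
    then show ?thesis by (simp only: qint_add[symmetric] card_D)
  qed
  also have "\<epsilon> ^ m * S * (p ^ m * qint (Suc n) p) =
      (\<epsilon> ^ Suc n * q) ^ m * (\<Prod>k=1..Suc n. qint k (\<epsilon> ^ (k - 1) * q))"
    by (simp add: S_def p_def power_mult_distrib ac_simps)
  finally show ?case by (simp only: U_X m_def)
qed

lemma sum_rmaj:
  fixes X :: "'a::linorder set" and q \<epsilon> :: "'b::comm_ring_1"
  assumes \<epsilon>: "\<epsilon> ^ 2 = 1" and X: "finite X"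
  shows "(\<Sum>xs\<in>permutations_of_set X. \<epsilon> ^ rinv xs * q ^ rmaj xs) =
         (\<Prod>k=1..card X. qint k (\<epsilon> ^ (k - 1) * q))"
proof (cases "card X")
  case 0
  then show ?thesis using X by simp
next
  case (Suc n)
  then have ne: "X \<noteq> {}" by auto
  have "(\<Sum>xs\<in>permutations_of_set X. \<epsilon> ^ rinv xs * q ^ rmaj xs) =
      (\<Sum>x\<in>X. (\<epsilon> ^ n * q) ^ card {y\<in>X. x < y}) * (\<Prod>k=1..n. qint k (\<epsilon> ^ (k - 1) * q))"
    using sum_rmaj_Cons[OF \<epsilon> X _ Suc]
    by (simp add: sum_permutations_of_set_Cons[OF X ne] sum_distrib_right
        del: rinv.simps rmaj.simps)
  then show ?thesis by (simp add: sum_power_card_greater X Suc mult.commute)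
qed

section \<open>Colored permutations as words in signed integers\<close>

definition key :: "colored \<Rightarrow> int" where
  "key x = (if snd x = 0 then int (fst x) else - int (fst x))"

text \<open>
  Letters of one word have distinct absolute values, and the order of two such letters depends on
  their colors only through whether these vanish.
\<close>
lemma cless_iff_key_less: "fst x \<noteq> fst y \<Longrightarrow> cless x y \<longleftrightarrow> key x < key y"
  by (auto simp: cless_def key_def)

definition rword :: "nat \<Rightarrow> colored_word \<Rightarrow> int list" where
  "rword n \<pi> = map (\<lambda>i. key (\<pi> i)) (rev [1..<Suc n])"

lemma rmaj_map_rev_upt:
  "rmaj (map f (rev [1..<Suc n])) = (\<Sum>i | 1 \<le> i \<and> i < n \<and> f (i + 1) < f i. i)"
proof (induction n)
  case 0
  then show ?case by simp
next
  case (Suc n)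
  show ?case
  proof (cases n)
    case 0
    then have "{i. 1 \<le> i \<and> i < Suc n \<and> f (i + 1) < f i} = {}" by auto
    with 0 show ?thesis by (simp only: sum.empty) simp
  next
    case (Suc m)
    have "{i. 1 \<le> i \<and> i < Suc n \<and> f (i + 1) < f i} =
        (if f (Suc n) < f n then {n} else {}) \<union> {i. 1 \<le> i \<and> i < n \<and> f (i + 1) < f i}"
      using Suc by (auto simp: less_Suc_eq)
    then have "(\<Sum>i | 1 \<le> i \<and> i < Suc n \<and> f (i + 1) < f i. i) =
        (if f (Suc n) < f n then n else 0) + (\<Sum>i | 1 \<le> i \<and> i < n \<and> f (i + 1) < f i. i)"
      by simp
    also have "\<dots> = rmaj (map f (rev [1..<Suc (Suc n)]))"
      unfolding Suc.IH[symmetric] by (simp add: Suc)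
    finally show ?thesis by simp
  qed
qed

lemma G_fst_permutes: "\<pi> \<in> G r n \<Longrightarrow> (\<lambda>i. fst (\<pi> i)) permutes {1..n}"
  by (simp add: G_def)

lemma G_fst_eq_iff: "\<pi> \<in> G r n \<Longrightarrow> fst (\<pi> i) = fst (\<pi> j) \<longleftrightarrow> i = j"
  using permutes_inj[OF G_fst_permutes] by (auto dest: injD)

lemma G_fst_ge_1: "\<pi> \<in> G r n \<Longrightarrow> i \<in> {1..n} \<Longrightarrow> 1 \<le> fst (\<pi> i)"
  using permutes_in_image[OF G_fst_permutes] by fastforce

lemma G_snd_mod: "\<pi> \<in> G r n \<Longrightarrow> snd (\<pi> i) mod r = snd (\<pi> i)"
  by (cases "i \<in> {1..n}") (simp_all add: G_def)

lemma G_key_eq_iff: "\<pi> \<in> G r n \<Longrightarrow> key (\<pi> i) = key (\<pi> j) \<longleftrightarrow> i = j"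
  using G_fst_eq_iff[of \<pi> r n i j] by (auto simp: key_def split: if_splits)

lemma maj_eq_rmaj:
  assumes "\<pi> \<in> G r n"
  shows "maj n \<pi> = rmaj (rword n \<pi>)"
proof -
  have "cless (\<pi> (i + 1)) (\<pi> i) \<longleftrightarrow> key (\<pi> (i + 1)) < key (\<pi> i)" for i
    using G_fst_eq_iff[OF assms, of "i + 1" i] by (intro cless_iff_key_less) simp
  then show ?thesis unfolding maj_def rword_def rmaj_map_rev_upt by simp
qed

section \<open>The length function\<close>

text \<open>
  Bagno's formula is obtained by comparing \<open>bagno\<close> with words in the generators. Multiplication by a
  generator on the right either exchanges two neighboring letters, which changes the inversion number by \<open>1\<close>,
  or rotates the color of the first letter. In both cases \<open>bagno\<close> grows by at most \<open>1\<close>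
  (\<open>cmult_gen_step\<close>), which bounds the length from below. Conversely, every element other than the
  identity is obtained in this way from an element whose value is smaller by \<open>1\<close> (\<open>bagno_decrease\<close>).
\<close>
definition color_cost :: "colored \<Rightarrow> nat" where
  "color_cost x = (if snd x = 0 then 0 else fst x + snd x - 1)"

definition bagno :: "nat \<Rightarrow> colored_word \<Rightarrow> nat" where
  "bagno n \<pi> = rinv (rword n \<pi>) + (\<Sum>i=1..n. color_cost (\<pi> i))"

lemma rinv_append_swap:
  "x < y \<Longrightarrow> rinv (us @ x # y # vs) = Suc (rinv (us @ y # x # vs))"
  by (induction us) auto

lemma rinv_snoc: "rinv (xs @ [x]) = rinv xs + length (filter (\<lambda>y. y < x) xs)"
  by (induction xs) auto

lemma rinv_map_transpose:
  assumes "1 \<le> i" "i < n" and descent: "f (i + 1) < f i"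
  shows "rinv (map f (rev [1..<Suc n])) =
         Suc (rinv (map (f \<circ> Transposition.transpose i (i + 1)) (rev [1..<Suc n])))"
proof -
  have "[1..<Suc n] = [1..<i] @ [i..<Suc n]"
    using assms upt_add_eq_append[of 1 i "Suc n - i"] by simp
  also have "[i..<Suc n] = i # (i + 1) # [i + 2..<Suc n]"
    using assms by (simp add: upt_conv_Cons)
  finally have L: "rev [1..<Suc n] = rev [i + 2..<Suc n] @ (i + 1) # i # rev [1..<i]"
    by simp
  have "map (f \<circ> Transposition.transpose i (i + 1)) (rev [i + 2..<Suc n]) =
        map f (rev [i + 2..<Suc n])"
    "map (f \<circ> Transposition.transpose i (i + 1)) (rev [1..<i]) = map f (rev [1..<i])"
    by (auto simp: Transposition.transpose_def)
  then have "map (f \<circ> Transposition.transpose i (i + 1)) (rev [1..<Suc n]) =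
      map f (rev [i + 2..<Suc n]) @ f i # f (i + 1) # map f (rev [1..<i])"
    unfolding L map_append list.map by simp
  then show ?thesis
    unfolding L map_append list.map by (simp only: rinv_append_swap[OF descent])
qed

lemma act_letter: "\<pi> \<in> G r n \<Longrightarrow> act r \<pi> (i, 0) = \<pi> i"
  by (simp add: act_def G_snd_mod prod_eq_iff)

lemma cmult_gen_0:
  assumes "\<pi> \<in> G r n"
  shows "cmult r \<pi> (gen r 0) = \<pi>(1 := (fst (\<pi> 1), (snd (\<pi> 1) + 1) mod r))"
proof (rule ext)
  fix i
  show "cmult r \<pi> (gen r 0) i = (\<pi>(1 := (fst (\<pi> 1), (snd (\<pi> 1) + 1) mod r))) i"
  proof (cases "i = 1")
    case True
    then show ?thesis by (simp add: cmult_def gen_def act_def mod_add_right_eq del: One_nat_def)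
  next
    case False
    then show ?thesis by (simp add: cmult_def gen_def cid_def act_letter[OF assms])
  qed
qed

lemma cmult_gen_pos:
  assumes "\<pi> \<in> G r n" "i \<noteq> 0"
  shows "cmult r \<pi> (gen r i) = \<pi> \<circ> Transposition.transpose i (i + 1)"
  using assms(2) by (auto simp: cmult_def gen_def act_letter[OF assms(1)])

lemma G_transpose:
  assumes "\<pi> \<in> G r n" "1 \<le> i" "i < n"
  shows "\<pi> \<circ> Transposition.transpose i (i + 1) \<in> G r n"
proof -
  let ?t = "Transposition.transpose i (i + 1)"
  have t: "?t permutes {1..n}" using assms by (intro permutes_swap_id) auto
  have "(\<lambda>i. fst (\<pi> i)) \<circ> ?t permutes {1..n}"
    by (rule permutes_compose[OF t G_fst_permutes[OF assms(1)]])
  moreover have "?t j \<in> {1..n} \<longleftrightarrow> j \<in> {1..n}" for j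
    by (rule permutes_in_image[OF t])
  ultimately show ?thesis using assms(1) by (auto simp: G_def o_def simp del: atLeastAtMost_iff)
qed

lemma G_first_color:
  assumes "\<pi> \<in> G r n" "z < r" "1 \<le> n"
  shows "\<pi>(1 := (fst (\<pi> 1), z)) \<in> G r n"
proof -
  have "(\<lambda>i. fst ((\<pi>(1 := (fst (\<pi> 1), z))) i)) = (\<lambda>i. fst (\<pi> i))" by auto
  then show ?thesis using assms by (simp add: G_def)
qed

lemma bagno_descent:
  assumes "1 \<le> i" "i < n" "key (\<pi> (i + 1)) < key (\<pi> i)"
  shows "bagno n \<pi> = Suc (bagno n (\<pi> \<circ> Transposition.transpose i (i + 1)))"
proof -
  let ?t = "Transposition.transpose i (i + 1)"
  have t: "?t permutes {1..n}" using assms by (intro permutes_swap_id) auto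
  have "(\<Sum>i=1..n. color_cost (\<pi> i)) = (\<Sum>i=1..n. color_cost ((\<pi> \<circ> ?t) i))"
    using sum.permute[OF t, of "\<lambda>i. color_cost (\<pi> i)"] by (simp add: o_def)
  then show ?thesis
    using rinv_map_transpose[of i n "\<lambda>i. key (\<pi> i)"] assms by (simp add: bagno_def rword_def o_def)
qed

text \<open>
  All absolute values less than \<open>fst (\<pi> 1)\<close> occur after the first position. These are the letters
  whose comparison with the first letter changes when the first letter gets colored.
\<close>
lemma card_fst_less:
  assumes "\<pi> \<in> G r n" "1 \<le> n"
  shows "card {i\<in>{2..n}. fst (\<pi> i) < fst (\<pi> 1)} = fst (\<pi> 1) - 1"
proof -
  let ?\<sigma> = "\<lambda>i. fst (\<pi> i)" and ?A = "{i\<in>{2..n}. fst (\<pi> i) < fst (\<pi> 1)}"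
  have \<sigma>: "?\<sigma> permutes {1..n}" by (rule G_fst_permutes[OF assms(1)])
  have in_range: "?\<sigma> i \<in> {1..n} \<longleftrightarrow> i \<in> {1..n}" for i by (rule permutes_in_image[OF \<sigma>])
  have "?\<sigma> ` ?A = {1..<?\<sigma> 1}"
  proof (intro equalityI subsetI)
    fix v assume "v \<in> ?\<sigma> ` ?A"
    then obtain i where i: "i \<in> {2..n}" "v = ?\<sigma> i" "?\<sigma> i < ?\<sigma> 1" by auto
    then show "v \<in> {1..<?\<sigma> 1}" using in_range[of i] by auto
  next
    fix v assume v: "v \<in> {1..<?\<sigma> 1}"
    then have "v \<in> {1..n}" using in_range[of 1] assms(2) by auto
    then obtain i where i: "i \<in> {1..n}" "v = ?\<sigma> i" using permutes_image[OF \<sigma>] by blast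
    then have "i \<noteq> 1" using v by auto
    then show "v \<in> ?\<sigma> ` ?A" using i v by (intro image_eqI[of _ _ i]) auto
  qed
  moreover have "inj_on ?\<sigma> ?A" using permutes_inj[OF \<sigma>] by (rule inj_on_subset) simp
  ultimately show ?thesis by (metis card_image card_atLeastLessThan)
qed

text \<open>
  Between nonzero colors the word of keys does not change and the cost grows by \<open>1\<close>. From color \<open>0\<close>
  to color \<open>1\<close> the cost grows by \<open>v\<close>, the absolute value of the first letter, but the key drops from
  \<open>v\<close> to \<open>- v\<close>. This removes the inversions with the \<open>v - 1\<close> letters of smaller absolute value and no
  others.
\<close>
lemma bagno_first_color_Suc:
  assumes G: "\<pi> \<in> G r n" "1 \<le> n"
  shows "bagno n (\<pi>(1 := (fst (\<pi> 1), Suc z))) = Suc (bagno n (\<pi>(1 := (fst (\<pi> 1), z))))"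
proof -
  define v where "v = fst (\<pi> 1)"
  have v: "1 \<le> v" using G_fst_ge_1[OF G(1)] G(2) by (simp add: v_def)
  define us where "us = map (\<lambda>i. key (\<pi> i)) (rev [2..<Suc n])"
  have L: "rev [1..<Suc n] = rev [2..<Suc n] @ [1]"
    using G(2) by (simp add: upt_conv_Cons numeral_2_eq_2)
  have word: "rword n (\<pi>(1 := (v, y))) = us @ [key (v, y)]" for y
    unfolding rword_def us_def L by auto
  have tail_count: "length (filter P us) = card {i\<in>{2..n}. P (key (\<pi> i))}" for P
  proof -
    have "length (filter P us) = length (filter (\<lambda>i. P (key (\<pi> i))) [2..<Suc n])"
      by (simp add: us_def filter_map rev_filter[symmetric] o_def)
    also have "\<dots> = card (set (filter (\<lambda>i. P (key (\<pi> i))) [2..<Suc n]))"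
      by (intro distinct_card[symmetric]) simp
    also have "set (filter (\<lambda>i. P (key (\<pi> i))) [2..<Suc n]) = {i\<in>{2..n}. P (key (\<pi> i))}"
      by auto
    finally show ?thesis .
  qed
  have cost: "(\<Sum>i=1..n. color_cost ((\<pi>(1 := (v, y))) i)) =
      color_cost (v, y) + (\<Sum>i=2..n. color_cost (\<pi> i))" for y
  proof -
    have "{1..n} = insert 1 {2..n}" using G(2) by auto
    then show ?thesis by simp
  qed
  have "bagno n (\<pi>(1 := (v, Suc z))) = Suc (bagno n (\<pi>(1 := (v, z))))"
  proof (cases z)
    case 0
    have keys: "key (v, 0) = int v" "key (v, Suc 0) = - int v" by (simp_all add: key_def)
    have "{i\<in>{2..n}. key (\<pi> i) < int v} =
        {i\<in>{2..n}. key (\<pi> i) < - int v} \<union> {i\<in>{2..n}. fst (\<pi> i) < v}"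
    proof -
      have "key (\<pi> i) < int v \<longleftrightarrow> key (\<pi> i) < - int v \<or> fst (\<pi> i) < v" if "i \<in> {2..n}" for i
      proof -
        have "fst (\<pi> i) \<noteq> v" using G_fst_eq_iff[OF G(1), of i 1] that by (auto simp: v_def)
        then show ?thesis using v by (auto simp: key_def)
      qed
      then show ?thesis by blast
    qed
    moreover have "{i\<in>{2..n}. key (\<pi> i) < - int v} \<inter> {i\<in>{2..n}. fst (\<pi> i) < v} = {}"
      by (auto simp: key_def split: if_splits)
    ultimately have "card {i\<in>{2..n}. key (\<pi> i) < int v} =
        card {i\<in>{2..n}. key (\<pi> i) < - int v} + (v - 1)"
      using card_fst_less[OF G] by (simp add: card_Un_disjoint v_def)
    then show ?thesis
      unfolding 0 bagno_def word rinv_snoc tail_count cost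
      using v by (simp add: color_cost_def keys)
  next
    case (Suc y)
    then show ?thesis
      unfolding Suc bagno_def word cost
      using v by (simp add: color_cost_def key_def)
  qed
  then show ?thesis by (simp add: v_def)
qed

lemma bagno_first_color:
  assumes "\<pi> \<in> G r n" "1 \<le> n"
  shows "bagno n (\<pi>(1 := (fst (\<pi> 1), z))) = bagno n (\<pi>(1 := (fst (\<pi> 1), 0))) + z"
proof (induction z)
  case 0
  show ?case by simp
next
  case (Suc z)
  then show ?case by (simp only: bagno_first_color_Suc[OF assms] add_Suc_right)
qed

lemma cmult_gen_step:
  assumes G: "\<pi> \<in> G r n" and s: "s \<in> gens r n" and r: "1 \<le> r"
  shows "cmult r \<pi> s \<in> G r n" "bagno n (cmult r \<pi> s) \<le> Suc (bagno n \<pi>)"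
proof -
  from s obtain i where i: "s = gen r i" "i < n" by (auto simp: gens_def)
  have "cmult r \<pi> s \<in> G r n \<and> bagno n (cmult r \<pi> s) \<le> Suc (bagno n \<pi>)"
  proof (cases "i = 0")
    case True
    with i have n: "1 \<le> n" and s0: "s = gen r 0" by auto
    let ?v = "fst (\<pi> 1)" and ?z = "snd (\<pi> 1)"
    have "bagno n (cmult r \<pi> s) = bagno n (\<pi>(1 := (?v, 0))) + (?z + 1) mod r"
      unfolding s0 cmult_gen_0[OF G] by (rule bagno_first_color[OF G n])
    moreover have "bagno n \<pi> = bagno n (\<pi>(1 := (?v, 0))) + ?z"
      using bagno_first_color[OF G n, of ?z] by simp
    moreover have "(?z + 1) mod r \<le> ?z + 1" by simp
    moreover have "cmult r \<pi> s \<in> G r n"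
      unfolding s0 cmult_gen_0[OF G] by (rule G_first_color[OF G _ n]) (use r in simp)
    ultimately show ?thesis by linarith
  next
    case False
    let ?t = "Transposition.transpose i (i + 1)"
    have mult: "cmult r \<pi> s = \<pi> \<circ> ?t" unfolding i by (rule cmult_gen_pos[OF G False])
    have i1: "1 \<le> i" using False by simp
    consider "key (\<pi> (i + 1)) < key (\<pi> i)" | "key (\<pi> i) < key (\<pi> (i + 1))"
      using G_key_eq_iff[OF G, of i "i + 1"] by force
    then have "bagno n (\<pi> \<circ> ?t) \<le> Suc (bagno n \<pi>)"
    proof cases
      case 1
      then show ?thesis using bagno_descent[OF i1 i(2)] by simp
    next
      case 2
      then have "bagno n (\<pi> \<circ> ?t) = Suc (bagno n ((\<pi> \<circ> ?t) \<circ> ?t))"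
        by (intro bagno_descent[OF i1 i(2)]) simp
      then show ?thesis by (simp add: o_assoc[symmetric])
    qed
    then show ?thesis using mult G_transpose[OF G i1 i(2)] by simp
  qed
  then show "cmult r \<pi> s \<in> G r n" "bagno n (cmult r \<pi> s) \<le> Suc (bagno n \<pi>)" by auto
qed

lemma cid_in_G: "1 \<le> r \<Longrightarrow> cid \<in> G r n"
  using permutes_id[of "{1..n}"] by (simp add: G_def cid_def id_def)

lemma bagno_cid: "bagno n cid = 0"
proof -
  have "rinv (map int (rev [1..<Suc n])) = 0"
    by (induction n) (auto simp: filter_empty_conv)
  then show ?thesis by (simp add: bagno_def rword_def cid_def key_def color_cost_def)
qed

text \<open>
  An ascending word whose first key is positive has positive keys only, hence no colors, and an
  ascending permutation is the identity.
\<close>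
lemma no_descent_imp_cid:
  assumes G: "\<pi> \<in> G r n"
    and asc: "\<And>i. 1 \<le> i \<Longrightarrow> i < n \<Longrightarrow> key (\<pi> i) < key (\<pi> (i + 1))"
    and first: "1 \<le> n \<Longrightarrow> snd (\<pi> 1) = 0"
  shows "\<pi> = cid"
proof -
  have key_ge: "int i \<le> key (\<pi> i)" if "1 \<le> i" "i \<le> n" for i
    using that
  proof (induction i rule: dec_induct)
    case base
    then show ?case using first G_fst_ge_1[OF G, of 1] by (simp add: key_def)
  next
    case (step i)
    then show ?case using asc[of i] by simp
  qed
  have letter: "snd (\<pi> i) = 0 \<and> i \<le> fst (\<pi> i)" if "i \<in> {1..n}" for i
    using key_ge[of i] that by (auto simp: key_def split: if_splits)
  then have "(\<lambda>i. fst (\<pi> i)) = id"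
    by (intro permutes_natset_ge[OF G_fst_permutes[OF G]]) blast
  then have "fst (\<pi> i) = i" for i by (simp add: fun_eq_iff)
  moreover have "snd (\<pi> i) = 0" for i
    using letter G by (cases "i \<in> {1..n}") (auto simp: G_def)
  ultimately show ?thesis by (simp add: cid_def fun_eq_iff prod_eq_iff)
qed

text \<open>
  At a descent the two neighbors can be exchanged. Without descents the first letter must be colored,
  and its color can be lowered by \<open>1\<close>.
\<close>
lemma bagno_decrease:
  assumes G: "\<pi> \<in> G r n" and "\<pi> \<noteq> cid"
  obtains s \<rho> where "s \<in> gens r n" "\<rho> \<in> G r n" "cmult r \<rho> s = \<pi>" "bagno n \<pi> = Suc (bagno n \<rho>)"
proof -
  consider (descent) i where "1 \<le> i" "i < n" "key (\<pi> (i + 1)) < key (\<pi> i)"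
    | (color) "1 \<le> n" "snd (\<pi> 1) \<noteq> 0"
  proof (atomize_elim, rule ccontr)
    assume *: "\<not> ((\<exists>i. 1 \<le> i \<and> i < n \<and> key (\<pi> (i + 1)) < key (\<pi> i)) \<or> (1 \<le> n \<and> snd (\<pi> 1) \<noteq> 0))"
    have "\<pi> = cid"
    proof (rule no_descent_imp_cid[OF G])
      fix i assume i: "1 \<le> i" "i < n"
      have "key (\<pi> i) \<noteq> key (\<pi> (i + 1))" using G_key_eq_iff[OF G, of i "i + 1"] by simp
      moreover have "\<not> key (\<pi> (i + 1)) < key (\<pi> i)" using * i by blast
      ultimately show "key (\<pi> i) < key (\<pi> (i + 1))" by linarith
    qed (use * in blast)
    with assms(2) show False by contradiction
  qed
  then show thesis
  proof cases
    case descent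
    let ?t = "Transposition.transpose i (i + 1)"
    have i0: "i \<noteq> 0" using descent(1) by simp
    have "cmult r (\<pi> \<circ> ?t) (gen r i) = \<pi>"
      unfolding cmult_gen_pos[OF G_transpose[OF G descent(1,2)] i0]
      by (simp add: o_assoc[symmetric])
    then show thesis
      using descent bagno_descent[OF descent] G_transpose[OF G descent(1,2)]
      by (intro that[of "gen r i" "\<pi> \<circ> ?t"]) (auto simp: gens_def)
  next
    case color
    then obtain z where z: "snd (\<pi> 1) = Suc z" by (cases "snd (\<pi> 1)") auto
    have "1 \<in> {1..n}" using color(1) by simp
    then have "snd (\<pi> 1) < r" using G unfolding G_def by blast
    then have zr: "Suc z < r" by (simp only: z)
    let ?\<rho> = "\<pi>(1 := (fst (\<pi> 1), z))"
    have \<rho>: "?\<rho> \<in> G r n" using G_first_color[OF G _ color(1)] zr by simp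
    have \<pi>: "\<pi>(1 := (fst (\<pi> 1), Suc z)) = \<pi>"
      unfolding fun_upd_idem_iff using z by (simp add: prod_eq_iff)
    have "cmult r ?\<rho> (gen r 0) = \<pi>"
      unfolding cmult_gen_0[OF \<rho>] using zr \<pi> by simp
    moreover have "bagno n \<pi> = Suc (bagno n ?\<rho>)"
      using bagno_first_color_Suc[OF G color(1), of z] unfolding \<pi> .
    moreover have "gen r 0 \<in> gens r n"
      unfolding gens_def using color(1) by (intro CollectI exI[of _ 0]) simp
    ultimately show thesis using \<rho> that[of "gen r 0" ?\<rho>] by blast
  qed
qed

lemma cmult_assoc: "cmult r (cmult r \<pi> \<rho>) \<tau> = cmult r \<pi> (cmult r \<rho> \<tau>)"
  by (rule ext) (simp add: cmult_def[of r "cmult r \<pi> \<rho>"] act_cmult, simp add: cmult_def)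

lemma cmult_cid_left: "\<pi> \<in> G r n \<Longrightarrow> cmult r cid \<pi> = \<pi>"
  by (rule ext) (simp add: cmult_def act_def cid_def G_snd_mod)

lemma cmult_cid_right: "\<pi> \<in> G r n \<Longrightarrow> cmult r \<pi> cid = \<pi>"
  by (rule ext) (simp add: cmult_def cid_def act_letter)

text \<open>
  A generator is its own product with the identity, so closure under right multiplication applies.
\<close>
lemma gens_in_G: "s \<in> gens r n \<Longrightarrow> 1 \<le> r \<Longrightarrow> s \<in> G r n"
proof -
  assume s: "s \<in> gens r n" and r: "1 \<le> r"
  \<comment> \<open>The color of \<open>s_0\<close> is \<open>1 mod r\<close>, which covers \<open>r = 1\<close>.\<close>
  have "cmult r cid s = s"
    using s r by (auto simp: gens_def gen_def cmult_def act_def cid_def fun_eq_iff)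
  then show "s \<in> G r n" using cmult_gen_step(1)[OF cid_in_G[OF r] s r] by simp
qed

lemma foldr_cmult_snoc:
  assumes "s \<in> gens r n" "1 \<le> r"
  shows "foldr (cmult r) (ws @ [s]) cid = cmult r (foldr (cmult r) ws cid) s"
proof -
  have s: "s \<in> G r n" by (rule gens_in_G[OF assms])
  have "foldr (cmult r) ws s = cmult r (foldr (cmult r) ws cid) s"
    by (induction ws) (simp_all add: cmult_cid_left[OF s] cmult_assoc)
  then show ?thesis by (simp add: cmult_cid_right[OF s])
qed

lemma bagno_foldr_le:
  assumes "set ws \<subseteq> gens r n" "1 \<le> r"
  shows "foldr (cmult r) ws cid \<in> G r n \<and> bagno n (foldr (cmult r) ws cid) \<le> length ws"
  using assms(1)
proof (induction ws rule: rev_induct)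
  case Nil
  then show ?case using cid_in_G[OF assms(2)] by (simp add: bagno_cid)
next
  case (snoc s ws)
  then have IH: "foldr (cmult r) ws cid \<in> G r n" "bagno n (foldr (cmult r) ws cid) \<le> length ws"
    and s: "s \<in> gens r n" by auto
  show ?case
    unfolding foldr_cmult_snoc[OF s assms(2)]
    using cmult_gen_step[OF IH(1) s assms(2)] IH(2) by simp
qed

lemma bagno_attained:
  assumes "\<pi> \<in> G r n" "1 \<le> r"
  shows "\<exists>ws. length ws = bagno n \<pi> \<and> set ws \<subseteq> gens r n \<and> foldr (cmult r) ws cid = \<pi>"
  using assms(1)
proof (induction "bagno n \<pi>" arbitrary: \<pi> rule: less_induct)
  case less
  show ?case
  proof (cases "\<pi> = cid")
    case True
    then show ?thesis by (simp add: bagno_cid)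
  next
    case False
    then obtain s \<rho> where s: "s \<in> gens r n" and \<rho>: "\<rho> \<in> G r n"
      and mult: "cmult r \<rho> s = \<pi>" and decr: "bagno n \<pi> = Suc (bagno n \<rho>)"
      using bagno_decrease[OF less.prems] by metis
    then obtain ws where "length ws = bagno n \<rho>" "set ws \<subseteq> gens r n" "foldr (cmult r) ws cid = \<rho>"
      using less.hyps[of \<rho>] by auto
    then have "length (ws @ [s]) = bagno n \<pi>" "set (ws @ [s]) \<subseteq> gens r n"
      "foldr (cmult r) (ws @ [s]) cid = \<pi>"
      using s mult decr by (simp_all add: foldr_cmult_snoc[OF s assms(2)] del: foldr_append)
    then show ?thesis by blast
  qed
qed

lemma len_eq_bagno:
  assumes "\<pi> \<in> G r n" "1 \<le> r"
  shows "len r n \<pi> = bagno n \<pi>"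
  unfolding len_def
proof (rule Least_equality)
  show "\<exists>ws. length ws = bagno n \<pi> \<and> set ws \<subseteq> gens r n \<and> foldr (cmult r) ws cid = \<pi>"
    by (rule bagno_attained[OF assms])
  fix k
  assume "\<exists>ws. length ws = k \<and> set ws \<subseteq> gens r n \<and> foldr (cmult r) ws cid = \<pi>"
  then obtain ws where "length ws = k" "set ws \<subseteq> gens r n" "foldr (cmult r) ws cid = \<pi>"
    by blast
  then show "bagno n \<pi> \<le> k" using bagno_foldr_le[of ws r n] assms(2) by simp
qed

section \<open>Separating colors from arrangements\<close>

text \<open>
  Surjectivity comes from counting: both sides have \<open>n!\<close> elements.
\<close>
lemma bij_betw_permutes_arrangements:
  assumes g: "inj_on g {1..n}"
  shows "bij_betw (\<lambda>\<sigma>. map (\<lambda>i. g (\<sigma> i)) (rev [1..<Suc n])) {\<sigma>. \<sigma> permutes {1..n}}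
           (permutations_of_set (g ` {1..n}))"
    (is "bij_betw ?F ?P ?Q")
proof -
  have "inj_on ?F ?P"
  proof (rule inj_onI)
    fix \<sigma> \<tau> assume "\<sigma> \<in> ?P" "\<tau> \<in> ?P" and eq: "?F \<sigma> = ?F \<tau>"
    then have \<sigma>: "\<sigma> permutes {1..n}" and \<tau>: "\<tau> permutes {1..n}" by auto
    have "\<sigma> i = \<tau> i" for i
    proof (cases "i \<in> {1..n}")
      case True
      then have "i \<in> set (rev [1..<Suc n])" by auto
      with eq have "g (\<sigma> i) = g (\<tau> i)" unfolding map_eq_conv by (rule bspec)
      then show ?thesis
        using inj_onD[OF g] permutes_in_image[OF \<sigma>, of i] permutes_in_image[OF \<tau>, of i] True
        by blast
    next
      case False
      then show ?thesis
        using permutes_not_in[OF \<sigma>, of i] permutes_not_in[OF \<tau>, of i] by simp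
    qed
    then show "\<sigma> = \<tau>" by blast
  qed
  moreover have "?F ` ?P = ?Q"
  proof (rule card_subset_eq)
    show "finite ?Q" by simp
    show "?F ` ?P \<subseteq> ?Q"
    proof
      fix xs assume "xs \<in> ?F ` ?P"
      then obtain \<sigma> where \<sigma>: "\<sigma> permutes {1..n}" and xs: "xs = ?F \<sigma>" by auto
      have L: "set (rev [1..<Suc n]) = {1..n}" by auto
      have "inj_on (g \<circ> \<sigma>) {1..n}"
        using g permutes_inj_on[OF \<sigma>] permutes_image[OF \<sigma>] by (intro comp_inj_on) auto
      then have "distinct xs" unfolding xs distinct_map L by (simp add: o_def)
      moreover have "set xs = g ` {1..n}"
        unfolding xs set_map L using permutes_image[OF \<sigma>] by (metis image_image)
      ultimately show "xs \<in> ?Q" by (auto intro: permutations_of_setI)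
    qed
    show "card (?F ` ?P) = card ?Q"
      using \<open>inj_on ?F ?P\<close> card_permutations[of "{1..n}" n] g
      by (simp add: card_image)
  qed
  ultimately show ?thesis by (simp add: bij_betw_def)
qed

text \<open>
  The color function \<open>c\<close> is indexed by the absolute value of a letter and not by its position. Thus
  it determines the set of letters, and a product over letters does not depend on their order.
\<close>
lemma sum_G_eq_sum_colors_arrangements:
  fixes f :: "int list \<Rightarrow> 'b::comm_semiring_1"
  assumes "1 \<le> r"
  shows "(\<Sum>\<pi>\<in>G r n. (\<Prod>i=1..n. w (\<pi> i)) * f (rword n \<pi>)) =
    (\<Sum>c\<in>PiE {1..n} (\<lambda>_. {..<r}). (\<Prod>v=1..n. w (v, c v)) *
      (\<Sum>xs\<in>permutations_of_set ((\<lambda>v. key (v, c v)) ` {1..n}). f xs))"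
proof -
  let ?C = "PiE {1..n} (\<lambda>_. {..<r})" and ?P = "{\<sigma>. \<sigma> permutes {1..n}}"
  let ?L = "rev [1..<Suc n]"
  \<comment> \<open>Elements of \<open>PiE\<close> are undefined outside \<open>{1..n}\<close>, where words have color \<open>0\<close>.\<close>
  define \<Phi> where "\<Phi> \<pi> = (restrict (\<lambda>v. snd (\<pi> (inv (\<lambda>i. fst (\<pi> i)) v))) {1..n}, \<lambda>i. fst (\<pi> i))"
    for \<pi> :: colored_word
  let ?\<Psi> = "\<lambda>(c :: nat \<Rightarrow> nat, \<sigma> :: nat \<Rightarrow> nat). \<lambda>i. (\<sigma> i, if i \<in> {1..n} then c (\<sigma> i) else 0)"
  have "(\<Sum>\<pi>\<in>G r n. (\<Prod>i=1..n. w (\<pi> i)) * f (rword n \<pi>)) =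
      (\<Sum>(c, \<sigma>)\<in>?C \<times> ?P. (\<Prod>v=1..n. w (v, c v)) * f (map (\<lambda>i. key (\<sigma> i, c (\<sigma> i))) ?L))"
  proof (rule sum.reindex_bij_witness[where i = ?\<Psi> and j = \<Phi>])
    fix \<pi> assume \<pi>: "\<pi> \<in> G r n"
    have \<sigma>: "(\<lambda>i. fst (\<pi> i)) permutes {1..n}" by (rule G_fst_permutes[OF \<pi>])
    have inv_in: "inv (\<lambda>i. fst (\<pi> i)) v \<in> {1..n} \<longleftrightarrow> v \<in> {1..n}" for v
      by (rule permutes_in_image[OF permutes_inv[OF \<sigma>]])
    have range: "fst (\<pi> i) \<in> {1..n} \<longleftrightarrow> i \<in> {1..n}" for i
      using permutes_in_image[OF \<sigma>] .
    have inv: "inv (\<lambda>i. fst (\<pi> i)) (fst (\<pi> i)) = i" for i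
      using permutes_inverses(2)[OF \<sigma>] .
    define c where "c = fst (\<Phi> \<pi>)"
    have c: "c (fst (\<pi> i)) = snd (\<pi> i)" if "i \<in> {1..n}" for i
      unfolding c_def \<Phi>_def using that range[of i] inv by simp
    have \<Phi>: "\<Phi> \<pi> = (c, \<lambda>i. fst (\<pi> i))" by (simp add: c_def \<Phi>_def)
    show "?\<Psi> (\<Phi> \<pi>) = \<pi>"
      unfolding \<Phi> using \<pi> c by (auto simp: fun_eq_iff prod_eq_iff G_def)
    show "\<Phi> \<pi> \<in> ?C \<times> ?P"
      using \<pi> \<sigma> inv_in unfolding \<Phi>_def G_def by (auto simp del: atLeastAtMost_iff)
    have "(\<Prod>v=1..n. w (v, c v)) = (\<Prod>i=1..n. w (fst (\<pi> i), c (fst (\<pi> i))))"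
      using prod.permute[OF \<sigma>, of "\<lambda>v. w (v, c v)"] by (simp add: o_def)
    also have "\<dots> = (\<Prod>i=1..n. w (\<pi> i))" by (rule prod.cong) (simp_all add: c)
    finally have "(\<Prod>v=1..n. w (v, c v)) = (\<Prod>i=1..n. w (\<pi> i))" .
    moreover have "map (\<lambda>i. key (fst (\<pi> i), c (fst (\<pi> i)))) ?L = rword n \<pi>"
      unfolding rword_def by (rule map_cong) (auto simp: c)
    ultimately show "(case \<Phi> \<pi> of (c, \<sigma>) \<Rightarrow>
        (\<Prod>v=1..n. w (v, c v)) * f (map (\<lambda>i. key (\<sigma> i, c (\<sigma> i))) ?L)) =
        (\<Prod>i=1..n. w (\<pi> i)) * f (rword n \<pi>)"
      unfolding \<Phi> by simp
  next
    fix x assume "x \<in> ?C \<times> ?P"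
    then obtain c \<sigma> where x: "x = (c, \<sigma>)" and c: "c \<in> ?C" and \<sigma>: "\<sigma> permutes {1..n}" by auto
    have range: "\<sigma> i \<in> {1..n} \<longleftrightarrow> i \<in> {1..n}" for i by (rule permutes_in_image[OF \<sigma>])
    show "?\<Psi> x \<in> G r n"
      using c \<sigma> range unfolding x G_def by (auto simp: PiE_iff simp del: atLeastAtMost_iff)
    have inv_in: "inv \<sigma> v \<in> {1..n} \<longleftrightarrow> v \<in> {1..n}" for v
      by (rule permutes_in_image[OF permutes_inv[OF \<sigma>]])
    have "restrict (\<lambda>v. snd (?\<Psi> x (inv \<sigma> v))) {1..n} = c"
      using c inv_in permutes_inverses(1)[OF \<sigma>] unfolding x
      by (auto simp: fun_eq_iff restrict_def PiE_iff extensional_def simp del: atLeastAtMost_iff)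
    then show "\<Phi> (?\<Psi> x) = x" unfolding \<Phi>_def by (simp add: x)
  qed
  also have "\<dots> = (\<Sum>c\<in>?C. (\<Prod>v=1..n. w (v, c v)) *
      (\<Sum>\<sigma>\<in>?P. f (map (\<lambda>i. key (\<sigma> i, c (\<sigma> i))) ?L)))"
    by (simp add: sum.cartesian_product[symmetric] sum_distrib_left)
  also have "\<dots> = (\<Sum>c\<in>?C. (\<Prod>v=1..n. w (v, c v)) *
      (\<Sum>xs\<in>permutations_of_set ((\<lambda>v. key (v, c v)) ` {1..n}). f xs))"
  proof (intro sum.cong refl arg_cong2[where f = "(*)"])
    fix c
    have "inj_on (\<lambda>v. key (v, c v)) {1..n}"
      by (auto simp: inj_on_def key_def split: if_splits)
    from sum.reindex_bij_betw[OF bij_betw_permutes_arrangements[OF this], of f]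
    show "(\<Sum>\<sigma>\<in>?P. f (map (\<lambda>i. key (\<sigma> i, c (\<sigma> i))) ?L)) =
        (\<Sum>xs\<in>permutations_of_set ((\<lambda>v. key (v, c v)) ` {1..n}). f xs)" by simp
  qed
  finally show ?thesis .
qed

lemma sum_G_factor:
  fixes f :: "int list \<Rightarrow> 'b::comm_semiring_1"
  assumes "1 \<le> r"
    and f: "\<And>X. finite X \<Longrightarrow> card X = n \<Longrightarrow> (\<Sum>xs\<in>permutations_of_set X. f xs) = S"
  shows "(\<Sum>\<pi>\<in>G r n. (\<Prod>i=1..n. w (\<pi> i)) * f (rword n \<pi>)) =
         S * (\<Prod>v=1..n. \<Sum>z<r. w (v, z))"
proof -
  have "(\<Sum>xs\<in>permutations_of_set ((\<lambda>v. key (v, c v)) ` {1..n}). f xs) = S" for c :: "nat \<Rightarrow> nat"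
  proof (rule f)
    have "inj_on (\<lambda>v. key (v, c v)) {1..n}"
      by (auto simp: inj_on_def key_def split: if_splits)
    then show "card ((\<lambda>v. key (v, c v)) ` {1..n}) = n" by (simp add: card_image)
  qed simp
  then have "(\<Sum>\<pi>\<in>G r n. (\<Prod>i=1..n. w (\<pi> i)) * f (rword n \<pi>)) =
      (\<Sum>c\<in>PiE {1..n} (\<lambda>_. {..<r}). \<Prod>v=1..n. w (v, c v)) * S"
    unfolding sum_G_eq_sum_colors_arrangements[OF assms(1)] by (simp only: sum_distrib_right)
  also have "\<dots> = S * (\<Prod>v=1..n. \<Sum>z<r. w (v, z))"
    by (simp add: prod_sum_PiE mult.commute)
  finally show ?thesis .
qed

section \<open>The character and the color weights\<close>

text \<open>
  What a letter contributes to the length beyond its color. This is also the number of inversions of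
  absolute values that the letter causes in the word with ascending keys.
\<close>
definition color_sign_exp :: "colored \<Rightarrow> nat" where
  "color_sign_exp x = (if snd x = 0 then 0 else fst x - 1)"

definition color_weight :: "'b::comm_ring_1 \<Rightarrow> 'b \<Rightarrow> 'b \<Rightarrow> colored \<Rightarrow> 'b" where
  "color_weight \<epsilon> u q x = \<epsilon> ^ color_sign_exp x * u ^ snd x * q ^ color_cost x"

lemma sum_color_weight:
  assumes "1 \<le> r" "1 \<le> k"
  shows "(\<Sum>z<r. color_weight \<epsilon> u q (k, z)) =
         1 + \<epsilon> ^ (k - 1) * u * (q ^ k * qint (r - 1) (u * q))"
proof -
  obtain m where m: "r = Suc m" using assms(1) by (cases r) auto
  have "color_weight \<epsilon> u q (k, Suc z) = \<epsilon> ^ (k - 1) * u * q ^ k * (u * q) ^ z" for z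
    using assms(2)
    by (simp add: color_weight_def color_sign_exp_def color_cost_def power_add power_mult_distrib ac_simps)
  then show ?thesis
    unfolding m sum.lessThan_Suc_shift
    by (simp add: qint_def sum_distrib_left mult.assoc)
       (simp add: color_weight_def color_sign_exp_def color_cost_def)
qed

lemma prod_color_weight:
  "(\<Prod>i=1..n. color_weight \<epsilon> u q (\<pi> i)) =
   \<epsilon> ^ (\<Sum>i=1..n. color_sign_exp (\<pi> i)) * u ^ col n \<pi> * q ^ (\<Sum>i=1..n. color_cost (\<pi> i))"
  by (simp add: color_weight_def prod.distrib power_sum col_def)

lemma lmaj_eq_rmaj:
  assumes "\<pi> \<in> G r n"
  shows "lmaj n \<pi> = rmaj (rword n \<pi>) + (\<Sum>i=1..n. color_cost (\<pi> i))"
proof -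
  have "(\<Sum>i | i \<in> {1..n} \<and> snd (\<pi> i) > 0. fst (\<pi> i) + snd (\<pi> i) - 1) =
      (\<Sum>i=1..n. color_cost (\<pi> i))"
    by (rule sum.mono_neutral_cong_left) (auto simp: color_cost_def)
  then show ?thesis by (simp add: lmaj_def maj_eq_rmaj[OF assms])
qed

text \<open>
  By Bagno's formula the difference of length and color sum is a sum of natural numbers, so the
  integer power in the character is an ordinary power.
\<close>
lemma chi_eq:
  assumes G: "\<pi> \<in> G r n" and "1 \<le> r"
  shows "chi r n \<omega> a b \<pi> =
    ((-1) ^ a) ^ (rinv (rword n \<pi>) + (\<Sum>i=1..n. color_sign_exp (\<pi> i))) * (\<omega> ^ b) ^ col n \<pi>"
proof -
  have "color_cost (\<pi> i) = color_sign_exp (\<pi> i) + snd (\<pi> i)" if "i \<in> {1..n}" for i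
    using G_fst_ge_1[OF G that] by (auto simp: color_cost_def color_sign_exp_def)
  then have "len r n \<pi> = rinv (rword n \<pi>) + (\<Sum>i=1..n. color_sign_exp (\<pi> i)) + col n \<pi>"
    by (simp add: len_eq_bagno[OF assms] bagno_def col_def sum.distrib)
  then have "int a * (int (len r n \<pi>) - int (col n \<pi>)) =
      int (a * (rinv (rword n \<pi>) + (\<Sum>i=1..n. color_sign_exp (\<pi> i))))" by simp
  then show ?thesis unfolding chi_def by (simp only: power_int_of_nat power_mult)
qed

theorem theoremA:
  fixes r n a b :: nat and \<omega> :: complex
  assumes "r \<ge> 1" and "n \<ge> 1"
    and "primitive_root_of_unity r \<omega>"
    and "a \<in> {0, 1}" and "b \<in> {0..<r}"
  shows "(\<Sum>\<pi>\<in>G r n. smult (chi r n \<omega> a b \<pi>) (qvar ^ len r n \<pi>)) =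
           (\<Prod>k=1..n. qint k (smult ((-1) ^ a) qvar) *
              (1 + smult ((-1) ^ (a * (k - 1)) * \<omega> ^ b)
                     (qvar ^ k * qint (r - 1) (smult (\<omega> ^ b) qvar)))) \<and>
         (\<Sum>\<pi>\<in>G r n. smult (chi r n \<omega> a b \<pi>) (qvar ^ lmaj n \<pi>)) =
           (\<Prod>k=1..n. qint k (smult ((-1) ^ (a * (k - 1))) qvar) *
              (1 + smult ((-1) ^ (a * (k - 1)) * \<omega> ^ b)
                     (qvar ^ k * qint (r - 1) (smult (\<omega> ^ b) qvar))))"
proof -
  define \<epsilon> :: "complex poly" where "\<epsilon> = [:(-1) ^ a:]"
  define u where "u = [:\<omega> ^ b:]"
  define q where "q = qvar"
  have smult_\<epsilon>: "smult ((-1) ^ a) p = \<epsilon> * p"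
    and smult_\<epsilon>_power: "smult ((-1) ^ (a * k)) p = \<epsilon> ^ k * p"
    and smult_u: "smult (\<omega> ^ b) p = u * p"
    and smult_\<epsilon>_u: "smult ((-1) ^ (a * k) * \<omega> ^ b) p = \<epsilon> ^ k * u * p" for k p
    by (simp_all add: \<epsilon>_def u_def poly_const_pow power_mult mult.commute)
  have \<epsilon>2: "\<epsilon> ^ 2 = 1"
    by (simp add: \<epsilon>_def poly_const_pow power_mult[symmetric] one_pCons)
  have chi_mult: "smult (chi r n \<omega> a b \<pi>) p =
      \<epsilon> ^ rinv (rword n \<pi>) * \<epsilon> ^ (\<Sum>i=1..n. color_sign_exp (\<pi> i)) * u ^ col n \<pi> * p"
    if "\<pi> \<in> G r n" for \<pi> p
    by (simp add: chi_eq[OF that assms(1)] \<epsilon>_def u_def poly_const_pow power_add ac_simps)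
  have colors: "(\<Prod>v=1..n. \<Sum>z<r. color_weight \<epsilon> u q (v, z)) =
      (\<Prod>k=1..n. 1 + \<epsilon> ^ (k - 1) * u * (q ^ k * qint (r - 1) (u * q)))"
    by (intro prod.cong refl sum_color_weight[OF assms(1)]) simp
  have "(\<Sum>\<pi>\<in>G r n. smult (chi r n \<omega> a b \<pi>) (q ^ len r n \<pi>)) =
      (\<Sum>\<pi>\<in>G r n. (\<Prod>i=1..n. color_weight \<epsilon> u q (\<pi> i)) * (\<epsilon> * q) ^ rinv (rword n \<pi>))"
    by (rule sum.cong) (simp_all only: chi_mult prod_color_weight len_eq_bagno[OF _ assms(1)]
        bagno_def power_add power_mult_distrib ac_simps)
  also have "\<dots> = (\<Prod>k=1..n. qint k (\<epsilon> * q)) *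
      (\<Prod>k=1..n. 1 + \<epsilon> ^ (k - 1) * u * (q ^ k * qint (r - 1) (u * q)))"
    unfolding colors[symmetric] by (rule sum_G_factor[OF assms(1)]) (simp add: sum_rinv)
  finally have length_sum: "(\<Sum>\<pi>\<in>G r n. smult (chi r n \<omega> a b \<pi>) (q ^ len r n \<pi>)) = \<dots>" .
  have "(\<Sum>\<pi>\<in>G r n. smult (chi r n \<omega> a b \<pi>) (q ^ lmaj n \<pi>)) =
      (\<Sum>\<pi>\<in>G r n. (\<Prod>i=1..n. color_weight \<epsilon> u q (\<pi> i)) *
         (\<epsilon> ^ rinv (rword n \<pi>) * q ^ rmaj (rword n \<pi>)))"
    by (rule sum.cong) (simp_all only: chi_mult prod_color_weight lmaj_eq_rmaj
        power_add power_mult_distrib ac_simps)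
  also have "\<dots> = (\<Prod>k=1..n. qint k (\<epsilon> ^ (k - 1) * q)) *
      (\<Prod>k=1..n. 1 + \<epsilon> ^ (k - 1) * u * (q ^ k * qint (r - 1) (u * q)))"
    unfolding colors[symmetric] by (rule sum_G_factor[OF assms(1)]) (simp add: sum_rmaj[OF \<epsilon>2])
  finally have lmaj_sum: "(\<Sum>\<pi>\<in>G r n. smult (chi r n \<omega> a b \<pi>) (q ^ lmaj n \<pi>)) = \<dots>" .
  show ?thesis
    using length_sum lmaj_sum
    unfolding smult_\<epsilon> smult_\<epsilon>_power smult_\<epsilon>_u smult_u q_def[symmetric] prod.distrib by blast
qed

end
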